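(* Let $f:\mathbb{N}\to\mathbb{N}$ be a function with $f(0)=1$, $f(1)=2$, $f(x)>x$ and $f(x)\ge 2x$ for all $x\in\mathbb{N}$, and let $T_f(n)$ be the round complexity of the Increasing Degree problem $\Pi_f$ in $n$-node graphs. Then there exists a function $g:\mathbb{N}\to\mathbb{N}$ (with $g(0)=1$, $g(1)=2$ and $g(x)>x$ for all $x$) such that the round complexity $T_g(n)$ of the Increasing Degree problem $\Pi_g$ satisfies $$T_g(n)=\Theta\big(T_f(\log^\star n)\big).$$
   Context: Notation. $\mathbb{N}=\{0,1,2,\dots\}$. $\log^\star n$ is the number of times $\log_2$ must be applied to $n$ until the result is at most $1$. LOCAL model. The network is a simple connected graph $G=(V,E)$ with $n\ge 1$ nodes. Each node has an identifier in $[0,N]$, unique in the network, where $N$ is an upper bound on $n$ polynomial in $n$; $N$ may be given to the nodes. Initially a node knows only its identifier, degree and input label (and $N$). Computation proceeds in synchronous rounds, in each of which every node performs local computation and exchanges messages of arbitrary size with its neighbors; each node eventually outputs a label. The round complexity of a problem in $n$-node graphs is the minimum, over all deterministic algorithms solving it, of the maximum, over all $n$-node graphs (and identifier and input assignments), of the number of rounds until all nodes have output. Increasing Degree problem $\Pi_f$, for a function $f:\mathbb{N}\to\mathbb{N}$ with $f(x)>x$ for all $x$. A leaf is a node of degree $1$; $N(v)$ is the set of neighbors of $v$; $\sharp\mathrm{leaf}(v)$ is the number of leaves adjacent to $v$. A node $v$ is balanced (w.r.t. $f$) if $\deg(v)=1$ or $\sharp\mathrm{leaf}(w)<f(\sharp\mathrm{leaf}(v))$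 for all $w\in N(v)$; otherwise it is unbalanced, and every $w\in N(v)$ with $\sharp\mathrm{leaf}(w)\ge f(\sharp\mathrm{leaf}(v))$ is called a heavy neighbor of $v$. Each node $v$ receives an arbitrary input $\ell_{in}(v)\in\{0,1\}$ and must output $\ell_{out}(v)\in\{0,1\}$ such that: if $v$ is balanced then $\ell_{out}(v)=\ell_{in}(v)$; if $v$ is unbalanced then $\ell_{out}(v)=\ell_{out}(w)$ for at least one heavy neighbor $w$ of $v$. An algorithm solves $\Pi_f$ if these conditions hold at all nodes, for every input graph and every input assignment. *)

theory Defs
  imports Complex_Main "HOL-Library.Landau_Symbols" "HOL-Computational_Algebra.Polynomial"
begin

section \<open>Networks\<close>

text \<open>
  A network bundles everything the adversary chooses. The node names in \<open>nodes\<close> are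
  invisible to algorithms, which only see identifiers. The list \<open>ports G v\<close> enumerates the
  neighbours of \<open>v\<close>; position \<open>i\<close> in it is port \<open>i\<close> of \<open>v\<close>. It lets a node address its
  neighbours individually without knowing anything about them. The labels 0 and 1 are
  represented by \<open>bool\<close>.
\<close>

record network =
  nodes :: "nat set"
  edges :: "(nat \<times> nat) set"
  ports :: "nat \<Rightarrow> nat list"
  id_bound :: nat
  ident :: "nat \<Rightarrow> nat"
  input :: "nat \<Rightarrow> bool"

definition neighbors :: "network \<Rightarrow> nat \<Rightarrow> nat set" where
  "neighbors G v = {w. (v, w) \<in> edges G}"

definition deg :: "network \<Rightarrow> nat \<Rightarrow> nat" where
  "deg G v = card (neighbors G v)"

definition simple_connected_graph :: "network \<Rightarrow> bool" where
  "simple_connected_graph G \<longleftrightarrow>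
     finite (nodes G) \<and> nodes G \<noteq> {} \<and>
     edges G \<subseteq> nodes G \<times> nodes G \<and> sym (edges G) \<and> irrefl (edges G) \<and>
     (\<forall>u\<in>nodes G. \<forall>v\<in>nodes G. (u, v) \<in> (edges G)\<^sup>*)"

text \<open>
  The polynomial \<open>p\<close> is a parameter of the model: it limits how far the identifier bound may
  exceed the number of nodes.
\<close>

definition valid_network :: "nat poly \<Rightarrow> network \<Rightarrow> bool" where
  "valid_network p G \<longleftrightarrow>
     simple_connected_graph G \<and>
     (\<forall>v\<in>nodes G. distinct (ports G v) \<and> set (ports G v) = neighbors G v) \<and>
     card (nodes G) \<le> id_bound G \<and> id_bound G \<le> poly p (card (nodes G)) \<and>
     inj_on (ident G) (nodes G) \<and> ident G ` nodes G \<subseteq> {0..id_bound G}"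


section \<open>The LOCAL model\<close>

text \<open>
  States and messages are natural numbers. Since messages are unbounded and local computation
  is arbitrary, this amounts to allowing any countable type, and what a node can learn in
  finitely many rounds is a finite object.

  The arguments of \<open>init\<close> are the identifier bound, the own identifier, the own degree and the
  own input label; \<open>send A s i\<close> is the message sent through port \<open>i\<close>; the list passed to
  \<open>receive\<close> holds the incoming messages in port order; \<open>out A s = None\<close> means that the node
  has not yet decided.
\<close>

record algorithm =
  init :: "nat \<Rightarrow> nat \<Rightarrow> nat \<Rightarrow> bool \<Rightarrow> nat"
  send :: "nat \<Rightarrow> nat \<Rightarrow> nat"
  receive :: "nat \<Rightarrow> nat list \<Rightarrow> nat"
  out :: "nat \<Rightarrow> bool option"

definition port_to :: "network \<Rightarrow> nat \<Rightarrow> nat \<Rightarrow> nat" where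
  "port_to G u v = (THE i. i < length (ports G u) \<and> ports G u ! i = v)"

primrec state :: "algorithm \<Rightarrow> network \<Rightarrow> nat \<Rightarrow> nat \<Rightarrow> nat" where
  "state A G 0 v = init A (id_bound G) (ident G v) (deg G v) (input G v)"
| "state A G (Suc t) v =
     receive A (state A G t v) (map (\<lambda>u. send A (state A G t u) (port_to G u v)) (ports G v))"

definition has_output :: "algorithm \<Rightarrow> network \<Rightarrow> nat \<Rightarrow> nat \<Rightarrow> bool" where
  "has_output A G t v \<longleftrightarrow> (\<exists>s\<le>t. out A (state A G s v) \<noteq> None)"

text \<open>
  Outputs are irrevocable: only the first label a node announces counts. A node that has
  decided keeps taking part in the communication.
\<close>

definition final_output :: "algorithm \<Rightarrow> network \<Rightarrow> nat \<Rightarrow> bool" where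
  "final_output A G v = the (out A (state A G (LEAST t. has_output A G t v) v))"

definition rounds :: "algorithm \<Rightarrow> network \<Rightarrow> nat" where
  "rounds A G = (LEAST t. \<forall>v\<in>nodes G. has_output A G t v)"

text \<open>
  A problem relates a network, including its inputs, to the admissible output labellings.
\<close>

type_synonym problem = "network \<Rightarrow> (nat \<Rightarrow> bool) \<Rightarrow> bool"

definition solves :: "nat poly \<Rightarrow> algorithm \<Rightarrow> problem \<Rightarrow> bool" where
  "solves p A P \<longleftrightarrow>
     (\<forall>G. valid_network p G \<longrightarrow>
        (\<forall>v\<in>nodes G. \<exists>t. has_output A G t v) \<and> P G (final_output A G))"

text \<open>
  The minimum over all algorithms of the maximal number of rounds on \<open>n\<close>-node networks is the
  least \<open>T\<close> that bounds the number of rounds of some algorithm on all of them (unspecified if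
  no algorithm has a bound). The algorithm competing for a given \<open>n\<close> still has to be correct
  on networks of every size.
\<close>

definition round_complexity :: "nat poly \<Rightarrow> problem \<Rightarrow> nat \<Rightarrow> nat" where
  "round_complexity p P n =
     (LEAST T. \<exists>A. solves p A P \<and>
        (\<forall>G. valid_network p G \<and> card (nodes G) = n \<longrightarrow> rounds A G \<le> T))"


section \<open>The Increasing Degree problem\<close>

definition leaf_count :: "network \<Rightarrow> nat \<Rightarrow> nat" where
  "leaf_count G v = card {w \<in> neighbors G v. deg G w = 1}"

definition balanced :: "(nat \<Rightarrow> nat) \<Rightarrow> network \<Rightarrow> nat \<Rightarrow> bool" where
  "balanced f G v \<longleftrightarrow>
     deg G v = 1 \<or> (\<forall>w\<in>neighbors G v. leaf_count G w < f (leaf_count G v))"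

definition heavy_neighbors :: "(nat \<Rightarrow> nat) \<Rightarrow> network \<Rightarrow> nat \<Rightarrow> nat set" where
  "heavy_neighbors f G v = {w \<in> neighbors G v. leaf_count G w \<ge> f (leaf_count G v)}"

definition increasing_degree :: "(nat \<Rightarrow> nat) \<Rightarrow> problem" where
  "increasing_degree f G l \<longleftrightarrow>
     (\<forall>v\<in>nodes G.
        (balanced f G v \<longrightarrow> l v = input G v) \<and>
        (\<not> balanced f G v \<longrightarrow> (\<exists>w\<in>heavy_neighbors f G v. l v = l w)))"


section \<open>Iterated logarithm\<close>

definition log_star :: "nat \<Rightarrow> nat" where
  "log_star n = (LEAST k. (log 2 ^^ k) (real n) \<le> 1)"

end

theory Submission
  imports Defs "HOL-Library.Countable"
begin

text \<open>
  Following heavy neighbours in \<open>\<Pi>\<^sub>f\<close> traces a sequence of leaf counts \<open>c 0, c 1, \<dots>\<close> with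
  \<open>f (c i) \<le> c (i + 1)\<close>, and the label of a node is decided at the end of it. Hence, up to an
  additive constant, the round complexity on \<open>n\<close> nodes is the maximal length of such a chain that
  stays below \<open>n\<close>: passing labels backwards along chains takes this long, and on a caterpillar
  whose leaf counts form the chain, the first spine node must learn the input of the last one.
  Since \<open>f x \<ge> 2 * x\<close>, the size of the caterpillar is at most four times the last element of the
  chain, and dropping two elements makes up for this factor. With \<open>g = tower \<circ> f \<circ> log_star\<close> on positive numbers,
  chains for \<open>g\<close> up to \<open>n\<close> correspond to chains for \<open>f\<close> up to \<open>log_star n\<close>, again up to an
  additive constant, which does not matter because chains get arbitrarily long.
\<close>

section \<open>Chains of leaf counts\<close>

definition chain :: "(nat \<Rightarrow> nat) \<Rightarrow> (nat \<Rightarrow> nat) \<Rightarrow> nat \<Rightarrow> bool" where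
  "chain f c k \<longleftrightarrow> (\<forall>i<k. f (c i) \<le> c (Suc i))"

definition height :: "(nat \<Rightarrow> nat) \<Rightarrow> nat \<Rightarrow> nat" where
  "height f n = (GREATEST k. \<exists>c. chain f c k \<and> c k \<le> n)"

lemma chain_tail: "chain f c (Suc k) \<Longrightarrow> chain f (\<lambda>i. c (Suc i)) k"
  by (simp add: chain_def)

lemma chain_Cons: "chain f c k \<Longrightarrow> f x \<le> c 0 \<Longrightarrow> chain f (case_nat x c) (Suc k)"
  by (auto simp: chain_def split: nat.split)

lemma chain_strict:
  assumes f_gt: "\<And>x. f x > x" and "chain f c k" "i < k"
  shows "c i < c (Suc i)"
  using assms(2,3) less_le_trans[OF f_gt] unfolding chain_def by blast

lemma chain_ge_index:
  assumes f_gt: "\<And>x. f x > x" and "chain f c k"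
  shows "i \<le> k \<Longrightarrow> c 0 + i \<le> c i"
proof (induction i)
  case (Suc i)
  then show ?case using chain_strict[OF assms, of i] by simp
qed simp

text \<open>A chain gains at least one per step, so one ending at or below \<open>n\<close> has at
  most \<open>n\<close> steps. This bound is what makes the \<open>GREATEST\<close> in
  \<open>height\<close> meaningful.\<close>

lemma height_ge:
  assumes f_gt: "\<And>x. f x > x" and "chain f c k" "c k \<le> n"
  shows "k \<le> height f n"
  unfolding height_def
proof (rule Greatest_le_nat[where b = n])
  show "\<exists>c. chain f c k \<and> c k \<le> n" using assms by blast
  show "k' \<le> n" if "\<exists>c. chain f c k' \<and> c k' \<le> n" for k'
    using that chain_ge_index[OF f_gt, of _ k' k'] by fastforce
qed

lemma height_chain:
  assumes f_gt: "\<And>x. f x > x"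
  obtains c where "chain f c (height f n)" "c (height f n) \<le> n"
proof -
  have "\<exists>c. chain f c (height f n) \<and> c (height f n) \<le> n"
    unfolding height_def
  proof (rule GreatestI_nat[where b = n and k = 0])
    show "\<exists>c. chain f c 0 \<and> c 0 \<le> n" by (auto simp: chain_def)
    show "k' \<le> n" if "\<exists>c. chain f c k' \<and> c k' \<le> n" for k'
      using that chain_ge_index[OF f_gt, of _ k' k'] by fastforce
  qed
  then show ?thesis using that by blast
qed

text \<open>The iterates of \<open>f\<close> from 0 form arbitrarily long chains. Additive constants
  are therefore eventually negligible.\<close>

lemma height_unbounded:
  assumes f_gt: "\<And>x. f x > x"
  shows "\<forall>\<^sub>F n in sequentially. k \<le> height f n"
  using height_ge[OF f_gt, of "\<lambda>i. (f ^^ i) 0" k]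
  by (auto simp: eventually_sequentially chain_def)

text \<open>Each element is at most half of the next, so the sum is dominated by a geometric
  series.\<close>

lemma chain_sum_le:
  assumes f_double: "\<And>x. f x \<ge> 2 * x" and "chain f c k"
  shows "(\<Sum>i\<le>k. c i) \<le> 2 * c k"
  using assms(2)
proof (induction k)
  case (Suc k)
  have "2 * c k \<le> c (Suc k)"
    using Suc.prems f_double[of "c k"] unfolding chain_def by (meson le_trans lessI)
  with Suc show ?case by (fastforce simp: chain_def)
qed simp


section \<open>The algorithm\<close>

lemma has_output_mono: "has_output A G s v \<Longrightarrow> s \<le> t \<Longrightarrow> has_output A G t v"
  unfolding has_output_def using le_trans by blast

lemma rounds_le: "(\<And>v. v \<in> nodes G \<Longrightarrow> has_output A G t v) \<Longrightarrow> rounds A G \<le> t"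
  unfolding rounds_def by (rule Least_le) blast

lemma has_output_rounds:
  assumes "finite (nodes G)" "\<And>v. v \<in> nodes G \<Longrightarrow> \<exists>t. has_output A G t v" "v \<in> nodes G"
  shows "has_output A G (rounds A G) v"
proof -
  obtain t where t: "\<And>v. v \<in> nodes G \<Longrightarrow> has_output A G (t v) v"
    using assms(2) by metis
  have "\<forall>v\<in>nodes G. has_output A G (Max (t ` nodes G)) v"
    using t assms(1) by (auto intro: has_output_mono[OF t])
  then have "\<forall>v\<in>nodes G. has_output A G (rounds A G) v"
    unfolding rounds_def by (rule LeastI)
  with assms(3) show ?thesis by blast
qed

text \<open>The first announcement of \<open>v\<close> happens by time \<open>t\<close>, and until
  then the two runs agree at \<open>v\<close>. This turns indistinguishability of states into
  equality of outputs.\<close>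

lemma final_output_eqI:
  assumes "\<And>s. s \<le> t \<Longrightarrow> state A G s v = state A G' s v" "has_output A G t v"
  shows "final_output A G v = final_output A G' v"
proof -
  let ?m = "LEAST t. has_output A G t v"
  have iff: "has_output A G s v \<longleftrightarrow> has_output A G' s v" if "s \<le> t" for s
    using that assms(1) by (auto simp: has_output_def)
  have m: "has_output A G ?m v" "?m \<le> t"
    using assms(2) by (auto intro: LeastI Least_le)
  have "(LEAST t. has_output A G' t v) = ?m"
  proof (rule Least_equality)
    show "has_output A G' ?m v" using m iff by simp
    show "?m \<le> y" if "has_output A G' y v" for y
    proof (cases "y \<le> t")
      case True
      then show ?thesis using that iff by (simp add: Least_le)
    qed (use m in simp)
  qed
  then show ?thesis using m(2) assms(1)[of ?m] by (simp add: final_output_def)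
qed

section \<open>The label-copying algorithm and its states\<close>

datatype node_state =
  Start nat bool
| Counted nat nat bool
| Following nat
| Decided bool

instance node_state :: countable
  by countable_datatype

text \<open>All nodes are in phase \<open>Start\<close> at time 0 and in phase
  \<open>Counted\<close> at time 1, so the first two exchanges carry degrees and leaf counts.
  Afterwards 0 means undecided, and 1 and 2 encode the labels.\<close>

fun message :: "node_state \<Rightarrow> nat" where
  "message (Start d b) = d"
| "message (Counted d l b) = l"
| "message (Following i) = 0"
| "message (Decided b) = (if b then 2 else 1)"

fun update :: "(nat \<Rightarrow> nat) \<Rightarrow> node_state \<Rightarrow> nat list \<Rightarrow> node_state" where
  "update f (Start d b) ms = Counted d (length (filter (\<lambda>m. m = 1) ms)) b"
| "update f (Counted d l b) ms =
     (if d \<noteq> 1 \<and> (\<exists>i<length ms. f l \<le> ms ! i)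
      then Following (LEAST i. i < length ms \<and> f l \<le> ms ! i) else Decided b)"
| "update f (Following i) ms = (if ms ! i = 0 then Following i else Decided (ms ! i = 2))"
| "update f (Decided b) ms = Decided b"

fun decision :: "node_state \<Rightarrow> bool option" where
  "decision (Decided b) = Some b"
| "decision _ = None"

definition follow_heavy :: "(nat \<Rightarrow> nat) \<Rightarrow> algorithm" where
  "follow_heavy f =
     \<lparr>init = (\<lambda>N x d b. to_nat (Start d b)),
      send = (\<lambda>s i. message (from_nat s)),
      receive = (\<lambda>s ms. to_nat (update f (from_nat s) ms)),
      out = (\<lambda>s. decision (from_nat s))\<rparr>"

definition local_state :: "(nat \<Rightarrow> nat) \<Rightarrow> network \<Rightarrow> nat \<Rightarrow> nat \<Rightarrow> node_state" where
  "local_state f G t v = from_nat (state (follow_heavy f) G t v)"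

lemma local_state_0: "local_state f G 0 v = Start (deg G v) (input G v)"
  by (simp add: local_state_def follow_heavy_def)

lemma local_state_Suc:
  "local_state f G (Suc t) v =
     update f (local_state f G t v) (map (\<lambda>u. message (local_state f G t u)) (ports G v))"
  by (simp add: local_state_def follow_heavy_def)

lemma out_follow_heavy:
  "out (follow_heavy f) (state (follow_heavy f) G t v) = decision (local_state f G t v)"
  by (simp add: local_state_def follow_heavy_def)

lemma decision_eq_Some [simp]: "decision s = Some b \<longleftrightarrow> s = Decided b"
  by (cases s) auto

lemma decided_mono: "local_state f G t v = Decided b \<Longrightarrow> t \<le> t' \<Longrightarrow> local_state f G t' v = Decided b"
  by (rotate_tac 1, induction t' rule: dec_induct) (simp_all add: local_state_Suc)

lemma has_output_follow_heavy:
  "has_output (follow_heavy f) G t v \<longleftrightarrow> (\<exists>b. local_state f G t v = Decided b)"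
  unfolding has_output_def out_follow_heavy using decided_mono[of f G _ v _ t]
  by (auto simp: not_None_eq)

lemma final_output_follow_heavy:
  assumes "local_state f G t v = Decided b"
  shows "final_output (follow_heavy f) G v = b"
proof -
  let ?m = "LEAST t. has_output (follow_heavy f) G t v"
  have *: "has_output (follow_heavy f) G t v"
    using assms by (auto simp: has_output_follow_heavy)
  obtain b' where b': "local_state f G ?m v = Decided b'"
    using LeastI[of "\<lambda>t. has_output (follow_heavy f) G t v", OF *]
    by (auto simp: has_output_follow_heavy)
  have "?m \<le> t" using * by (rule Least_le)
  with decided_mono[OF b'] b' assms
  show ?thesis by (simp add: final_output_def out_follow_heavy)
qed

section \<open>Runs of the algorithm on a fixed network\<close>

context
  fixes p :: "nat poly" and G :: network and f :: "nat \<Rightarrow> nat"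
  assumes valid: "valid_network p G"
begin

lemma valid_ports:
  "v \<in> nodes G \<Longrightarrow> distinct (ports G v)" "v \<in> nodes G \<Longrightarrow> set (ports G v) = neighbors G v"
  using valid by (auto simp: valid_network_def)

lemma finite_nodes: "finite (nodes G)"
  using valid by (simp add: valid_network_def simple_connected_graph_def)

lemma neighbors_nodes: "v \<in> neighbors G u \<Longrightarrow> v \<in> nodes G"
  using valid by (auto simp: valid_network_def simple_connected_graph_def neighbors_def)

lemma leaf_count_le: "leaf_count G v \<le> card (nodes G)"
  unfolding leaf_count_def by (rule card_mono[OF finite_nodes]) (auto dest: neighbors_nodes)

lemma local_state_1:
  assumes "v \<in> nodes G"
  shows "local_state f G 1 v = Counted (deg G v) (leaf_count G v) (input G v)"
proof -
  have "leaf_count G v = card (set (filter (\<lambda>u. deg G u = 1) (ports G v)))"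
    using valid_ports[OF assms] by (simp add: leaf_count_def)
  also have "\<dots> = length (filter (\<lambda>u. deg G u = 1) (ports G v))"
    using valid_ports[OF assms] by (intro distinct_card) simp
  finally show ?thesis
    by (simp add: local_state_Suc local_state_0 filter_map o_def)
qed

lemma local_state_2:
  assumes "v \<in> nodes G"
  shows "balanced f G v \<Longrightarrow> local_state f G 2 v = Decided (input G v)"
    and "\<not> balanced f G v \<Longrightarrow>
      \<exists>i < length (ports G v). local_state f G 2 v = Following i \<and> ports G v ! i \<in> heavy_neighbors f G v"
proof -
  let ?ps = "ports G v"
  let ?P = "\<lambda>i. i < length ?ps \<and> f (leaf_count G v) \<le> leaf_count G (?ps ! i)"
  have "map (\<lambda>u. message (local_state f G 1 u)) ?ps = map (leaf_count G) ?ps"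
    using valid_ports(2)[OF assms] neighbors_nodes by (auto simp: local_state_1 simp del: One_nat_def)
  moreover have "local_state f G 2 v =
      update f (local_state f G 1 v) (map (\<lambda>u. message (local_state f G 1 u)) ?ps)"
    using local_state_Suc[of f G 1 v] by (simp add: numeral_2_eq_2)
  ultimately have *: "local_state f G 2 v =
      update f (Counted (deg G v) (leaf_count G v) (input G v)) (map (leaf_count G) ?ps)"
    by (simp only: local_state_1[OF assms])
  have ex: "(\<exists>i. ?P i) \<longleftrightarrow> (\<exists>w\<in>neighbors G v. f (leaf_count G v) \<le> leaf_count G w)"
    using valid_ports(2)[OF assms] by (metis in_set_conv_nth)
  show "local_state f G 2 v = Decided (input G v)" if "balanced f G v"
    using that ex by (auto simp: * balanced_def not_le)
  show "\<exists>i < length ?ps. local_state f G 2 v = Following i \<and> ?ps ! i \<in> heavy_neighbors f G v"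
    if "\<not> balanced f G v"
  proof -
    have d: "deg G v \<noteq> 1" and e: "\<exists>i. ?P i"
      using that unfolding ex by (auto simp: balanced_def not_less)
    define i where "i = (LEAST i. ?P i)"
    have P: "?P i" unfolding i_def using e by (rule LeastI_ex)
    have eq: "i = (LEAST i. i < length ?ps \<and> f (leaf_count G v) \<le> map (leaf_count G) ?ps ! i)"
      unfolding i_def by (rule arg_cong[of _ _ Least]) auto
    have "local_state f G 2 v = Following i"
      unfolding * using d e eq by auto
    moreover have "?ps ! i \<in> heavy_neighbors f G v"
      using P valid_ports(2)[OF assms] nth_mem[of i ?ps] by (auto simp: heavy_neighbors_def)
    ultimately show ?thesis using P by blast
  qed
qed

lemma local_state_ge2:
  assumes "v \<in> nodes G"
  shows "(\<exists>i. local_state f G (Suc (Suc t)) v = Following i) \<or> (\<exists>b. local_state f G (Suc (Suc t)) v = Decided b)"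
proof (induction t)
  case 0
  show ?case using local_state_2[OF assms]
    by (cases "balanced f G v") (auto simp: numeral_2_eq_2)
next
  case (Suc t)
  then show ?case using local_state_Suc[of f G "Suc (Suc t)" v]
    by (cases "local_state f G (Suc (Suc t)) v") auto
qed

lemma following_const:
  assumes "v \<in> nodes G" "local_state f G 2 v = Following i" "local_state f G (Suc (Suc t)) v = Following j"
  shows "j = i"
  using assms(3)
proof (induction t arbitrary: j)
  case 0
  then show ?case using assms by (simp add: numeral_2_eq_2)
next
  case (Suc t)
  with local_state_ge2[OF assms(1), of t] local_state_Suc[of f G "Suc (Suc t)" v]
  show ?case by (auto split: if_splits)
qed

text \<open>A node that is still waiting must have heard "undecided" from the heavy neighbour it
  follows, so that neighbour was waiting one round earlier. Prepending the node's own leaf count to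
  the neighbour's chain gives the longer chain.\<close>

lemma following_chain:
  assumes "v \<in> nodes G" "local_state f G (Suc (Suc t)) v = Following i"
  shows "\<exists>c. chain f c (Suc t) \<and> c 0 = leaf_count G v \<and> c (Suc t) \<le> card (nodes G)"
  using assms
proof (induction t arbitrary: v i)
  case 0
  then obtain w where w: "w \<in> heavy_neighbors f G v"
    using local_state_2[of v] by (cases "balanced f G v") (auto simp: numeral_2_eq_2)
  have "chain f (case_nat (leaf_count G v) (\<lambda>_. leaf_count G w)) (Suc 0)"
    by (rule chain_Cons) (use w in \<open>auto simp: chain_def heavy_neighbors_def\<close>)
  then show ?case
    by (intro exI[of _ "case_nat (leaf_count G v) (\<lambda>_. leaf_count G w)"])
      (simp add: leaf_count_le)
next
  case (Suc t)
  have "\<not> balanced f G v"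
    using local_state_2(1)[OF Suc.prems(1)] decided_mono[of f G 2 v _ "Suc (Suc (Suc t))"] Suc.prems(2) by auto
  then obtain j where j: "j < length (ports G v)" "local_state f G 2 v = Following j"
      "ports G v ! j \<in> heavy_neighbors f G v"
    using local_state_2(2)[OF Suc.prems(1)] by blast
  let ?w = "ports G v ! j"
  have w: "?w \<in> nodes G" using j(3) neighbors_nodes by (auto simp: heavy_neighbors_def)
  have vt: "local_state f G (Suc (Suc t)) v = Following j"
    using local_state_ge2[OF Suc.prems(1), of t] Suc.prems decided_mono[of f G "Suc (Suc t)" v _ "Suc (Suc (Suc t))"]
      following_const[OF Suc.prems(1) j(2)] by fastforce
  \<comment> \<open>From time 2 on, only a \<open>Following\<close> node sends 0.\<close>
  have "message (local_state f G (Suc (Suc t)) ?w) = 0"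
    using Suc.prems(2) local_state_Suc[of f G "Suc (Suc t)" v] j(1) by (simp add: vt split: if_splits)
  then obtain i' where "local_state f G (Suc (Suc t)) ?w = Following i'"
    using local_state_ge2[OF w, of t] by (auto split: if_splits)
  then obtain c where c: "chain f c (Suc t)" "c 0 = leaf_count G ?w" "c (Suc t) \<le> card (nodes G)"
    using Suc.IH[OF w] by blast
  have "chain f (case_nat (leaf_count G v) c) (Suc (Suc t))"
    by (rule chain_Cons[OF c(1)]) (use j(3) c(2) in \<open>simp add: heavy_neighbors_def\<close>)
  then show ?case
    using c(3) by (intro exI[of _ "case_nat (leaf_count G v) c"]) simp
qed

context
  assumes f_gt: "\<And>x. f x > x"
begin

text \<open>A node undecided at this time would yield a chain with one step more than
  \<open>height\<close> allows.\<close>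

lemma has_output_height:
  assumes "v \<in> nodes G"
  shows "has_output (follow_heavy f) G (2 + height f (card (nodes G))) v"
proof (rule ccontr)
  assume "\<not> ?thesis"
  then obtain c where "chain f c (Suc (height f (card (nodes G))))"
      "c (Suc (height f (card (nodes G)))) \<le> card (nodes G)"
    using local_state_ge2[OF assms] following_chain[OF assms]
    by (metis has_output_follow_heavy add_2_eq_Suc)
  from height_ge[of f, OF f_gt this] show False by simp
qed

lemma rounds_follow_heavy: "rounds (follow_heavy f) G \<le> 2 + height f (card (nodes G))"
  by (rule rounds_le) (rule has_output_height)

lemma follow_heavy_correct: "increasing_degree f G (final_output (follow_heavy f) G)"
  unfolding increasing_degree_def
proof (intro ballI conjI impI)
  fix v assume v: "v \<in> nodes G"
  show "final_output (follow_heavy f) G v = input G v" if "balanced f G v"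
    using local_state_2(1)[OF v that] by (rule final_output_follow_heavy)
  assume "\<not> balanced f G v"
  then obtain i where i: "i < length (ports G v)" "local_state f G 2 v = Following i"
      "ports G v ! i \<in> heavy_neighbors f G v"
    using local_state_2(2)[OF v] by blast
  let ?w = "ports G v ! i" and ?D = "\<lambda>t. \<exists>b. local_state f G (Suc (Suc t)) v = Decided b"
  have w: "?w \<in> nodes G" using i(3) neighbors_nodes by (auto simp: heavy_neighbors_def)
  have "?D (height f (card (nodes G)))"
    using has_output_height[OF v] by (simp add: has_output_follow_heavy)
  moreover have "\<not> ?D 0" using i(2) by (simp add: numeral_2_eq_2)
  \<comment> \<open>The round in which \<open>v\<close> turns from following to decided: its label
    is then the one just sent by \<open>?w\<close>, which had already decided.\<close>
  ultimately obtain t where t: "\<not> ?D t" "?D (Suc t)"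
    using nat_induct[of "\<lambda>t. \<not> ?D t" "height f (card (nodes G))"] by blast
  then obtain b where b: "local_state f G (Suc (Suc (Suc t))) v = Decided b" by blast
  have "local_state f G (Suc (Suc t)) v = Following i"
    using t(1) local_state_ge2[OF v, of t] following_const[OF v i(2)] by blast
  then have "local_state f G (Suc (Suc t)) ?w = Decided b"
    using b local_state_Suc[of f G "Suc (Suc t)" v] i(1) local_state_ge2[OF w, of t]
    by (auto split: if_splits)
  with b have "final_output (follow_heavy f) G v = final_output (follow_heavy f) G ?w"
    by (simp only: final_output_follow_heavy)
  with i(3) show "\<exists>w\<in>heavy_neighbors f G v.
      final_output (follow_heavy f) G v = final_output (follow_heavy f) G w" by blast
qed

end

end

text \<open>\<open>follow_heavy\<close> witnesses that the set under the \<open>LEAST\<close> in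
  \<open>round_complexity\<close> is nonempty, so the minimum is both bounded by its running time
  and attained by some algorithm.\<close>

lemma round_complexity_attained:
  assumes f_gt: "\<And>x. f x > x"
  shows "round_complexity p (increasing_degree f) n \<le> 2 + height f n"
    and "\<exists>A. solves p A (increasing_degree f) \<and>
      (\<forall>G. valid_network p G \<and> card (nodes G) = n \<longrightarrow>
         rounds A G \<le> round_complexity p (increasing_degree f) n)"
proof -
  let ?Q = "\<lambda>T. \<exists>A. solves p A (increasing_degree f) \<and>
    (\<forall>G. valid_network p G \<and> card (nodes G) = n \<longrightarrow> rounds A G \<le> T)"
  have "solves p (follow_heavy f) (increasing_degree f)"
    unfolding solves_def using has_output_height follow_heavy_correct f_gt by blast
  then have *: "?Q (2 + height f n)"
    using rounds_follow_heavy f_gt by blast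
  show "round_complexity p (increasing_degree f) n \<le> 2 + height f n"
    unfolding round_complexity_def by (rule Least_le) (rule *)
  show "?Q (round_complexity p (increasing_degree f) n)"
    unfolding round_complexity_def by (rule LeastI) (rule *)
qed


section \<open>The lower bound\<close>

text \<open>Consecutive blocks of sizes \<open>c 0\<close>, ..., \<open>c k\<close> are assigned to
  the spine nodes in turn. The bound \<open>q j \<le> k\<close> is kept for all \<open>j\<close>,
  including those beyond the blocks, to make the parent function total without side
  conditions.\<close>

lemma ex_parent:
  "\<exists>q. (\<forall>i\<le>k. card {j. j < (\<Sum>i\<le>k. c i) \<and> q j = i} = c i) \<and> (\<forall>j. q j \<le> (k :: nat))"
proof (induction k)
  case 0
  show ?case by (rule exI[of _ "\<lambda>_. 0"]) simp
next
  case (Suc k)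
  let ?m = "\<Sum>i\<le>k. c i"
  obtain q where q: "\<And>i. i \<le> k \<Longrightarrow> card {j. j < ?m \<and> q j = i} = c i" "\<And>j. q j \<le> k"
    using Suc by blast
  let ?q = "\<lambda>j. if j < ?m then q j else Suc k"
  have "{j. j < ?m + c (Suc k) \<and> ?q j = i} = {j. j < ?m \<and> q j = i}" if "i \<le> k" for i
    using that by auto
  moreover have "{j. j < ?m + c (Suc k) \<and> ?q j = Suc k} = {?m..<?m + c (Suc k)}"
  proof -
    have "q j \<noteq> Suc k" for j using q(2)[of j] by simp
    then show ?thesis by auto
  qed
  ultimately show ?case
    using q by (intro exI[of _ ?q]) (auto simp: le_Suc_eq)
qed

text \<open>The root is 0; the tests for positivity keep its \<open>par\<close> value from creating
  an edge. Identifiers and the sorted ports do not depend on \<open>b\<close>, so two networks with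
  the same \<open>n\<close> and \<open>par\<close> differ in their inputs only.\<close>

definition tree_network :: "nat \<Rightarrow> (nat \<Rightarrow> nat) \<Rightarrow> (nat \<Rightarrow> bool) \<Rightarrow> network" where
  "tree_network n par b =
     (let E = {(u, v). u < n \<and> v < n \<and> (0 < v \<and> par v = u \<or> 0 < u \<and> par u = v)}
      in \<lparr>nodes = {..<n}, edges = E, ports = (\<lambda>v. sorted_list_of_set {w. (v, w) \<in> E}),
          id_bound = n, ident = id, input = b\<rparr>)"

lemma tree_network_simps [simp]:
  "nodes (tree_network n par b) = {..<n}" "id_bound (tree_network n par b) = n"
  "ident (tree_network n par b) = id" "input (tree_network n par b) = b"
  "ports (tree_network n par b) v = sorted_list_of_set (neighbors (tree_network n par b) v)"
  by (simp_all add: tree_network_def neighbors_def Let_def)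

lemma edges_tree_network:
  "(u, v) \<in> edges (tree_network n par b) \<longleftrightarrow>
     u < n \<and> v < n \<and> (0 < v \<and> par v = u \<or> 0 < u \<and> par u = v)"
  by (simp add: tree_network_def)

lemma neighbors_tree_network:
  "w \<in> neighbors (tree_network n par b) v \<longleftrightarrow>
     v < n \<and> w < n \<and> (0 < w \<and> par w = v \<or> 0 < v \<and> par v = w)"
  by (simp add: neighbors_def edges_tree_network)

lemma finite_neighbors_tree_network [simp]: "finite (neighbors (tree_network n par b) v)"
  by (rule finite_subset[of _ "{..<n}"]) (auto simp: neighbors_tree_network)

text \<open>Parents have smaller numbers, so every node reaches the root by descending; symmetry of
  the edges reverses these paths.\<close>

lemma valid_tree_network:
  assumes p_bound: "\<And>n. n \<ge> 1 \<Longrightarrow> n \<le> poly p n"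
    and n: "0 < n" and par: "\<And>v. 0 < v \<Longrightarrow> v < n \<Longrightarrow> par v < v"
  shows "valid_network p (tree_network n par b)"
proof -
  let ?G = "tree_network n par b"
  have root: "(v, 0) \<in> (edges ?G)\<^sup>*" if "v < n" for v
    using that
  proof (induction v rule: less_induct)
    case (less v)
    show ?case
    proof (cases "v = 0")
      case False
      then have "par v < v" "(v, par v) \<in> edges ?G"
        using par[of v] less.prems by (auto simp: edges_tree_network)
      with less show ?thesis by (meson converse_rtrancl_into_rtrancl order.strict_trans)
    qed simp
  qed
  have sym: "sym (edges ?G)" by (auto simp: sym_def edges_tree_network)
  have "(u, v) \<in> (edges ?G)\<^sup>*" if "u < n" "v < n" for u v
    using root[OF that(1)] symD[OF sym_rtrancl[OF sym] root[OF that(2)]] by (rule rtrancl_trans)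
  moreover have "irrefl (edges ?G)"
    by (auto simp: irrefl_def edges_tree_network dest: par)
  moreover have "edges ?G \<subseteq> {..<n} \<times> {..<n}"
    by (auto simp: edges_tree_network)
  ultimately have "simple_connected_graph ?G"
    using n sym by (auto simp: simple_connected_graph_def)
  with p_bound[of n] n show ?thesis
    by (auto simp: valid_network_def)
qed

text \<open>Since \<open>pos\<close> grows by at most one along an edge, an input at position
  \<open>k\<close> or beyond cannot influence \<open>v\<close> within fewer than
  \<open>k - pos v\<close> rounds.\<close>

lemma state_indistinguishable:
  assumes pos: "\<And>u v. (v, u) \<in> edges (tree_network n par b) \<Longrightarrow> pos u \<le> Suc (pos v)"
    and inp: "\<And>v. pos v < k \<Longrightarrow> b v = b' v"
    and "pos v + t < k"
  shows "state A (tree_network n par b) t v = state A (tree_network n par b') t v"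
  using assms(3)
proof (induction t arbitrary: v)
  case 0
  have "neighbors (tree_network n par b) = neighbors (tree_network n par b')"
    by (auto simp: fun_eq_iff neighbors_tree_network)
  with 0 inp show ?case by (simp add: deg_def)
next
  case (Suc t)
  have nb: "neighbors (tree_network n par b) = neighbors (tree_network n par b')"
    by (auto simp: fun_eq_iff neighbors_tree_network)
  have "state A (tree_network n par b) t u = state A (tree_network n par b') t u"
    if "u \<in> neighbors (tree_network n par b') v" for u
    using Suc.IH[of u] pos[of v u] Suc.prems that
    by (auto simp: neighbors_def[of _ v] edges_tree_network)
  then have "map (\<lambda>u. send A (state A (tree_network n par b) t u) (port_to (tree_network n par b) u v))
        (ports (tree_network n par b) v) =
      map (\<lambda>u. send A (state A (tree_network n par b') t u) (port_to (tree_network n par b') u v))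
        (ports (tree_network n par b') v)"
    by (intro map_cong) (simp_all add: port_to_def nb)
  moreover have "state A (tree_network n par b) t v = state A (tree_network n par b') t v"
    using Suc by simp
  ultimately show ?case by simp
qed

text \<open>
  A caterpillar: the spine is \<open>0, \<dots>, k\<close>, the remaining nodes are leaves, and \<open>q\<close> distributes
  them over the spine.
\<close>

definition spine_parent :: "nat \<Rightarrow> (nat \<Rightarrow> nat) \<Rightarrow> nat \<Rightarrow> nat" where
  "spine_parent k q v = (if v \<le> k then v - 1 else q (v - Suc k))"

text \<open>On the caterpillar, every solution labels node 0 with the input of node
  \<open>k\<close>, which is \<open>k\<close> hops away. The assumption \<open>1 \<le> c 0\<close>
  gives every spine node a leaf of its own, so the spine ends are not leaves themselves.\<close>

lemma round_complexity_ge: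
  assumes p_bound: "\<And>n. n \<ge> 1 \<Longrightarrow> n \<le> poly p n" and f_gt: "\<And>x. f x > x"
    and chain: "chain f c k" and c0: "1 \<le> c 0" and n: "(\<Sum>i\<le>k. c i) + Suc k = n"
  shows "k \<le> round_complexity p (increasing_degree f) n"
proof (rule ccontr)
  let ?T = "round_complexity p (increasing_degree f) n"
  assume "\<not> k \<le> ?T"
  then have T: "?T < k" by simp
  obtain q where q: "\<And>i. i \<le> k \<Longrightarrow> card {j. j < (\<Sum>i\<le>k. c i) \<and> q j = i} = c i" "\<And>j. q j \<le> k"
    using ex_parent[of k c] by blast
  define par where "par = spine_parent k q"
  define G where "G = tree_network n par"
  have par: "par v < v" if "0 < v" for v
    using that q(2)[of "v - Suc k"] by (auto simp: par_def spine_parent_def)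
  have par_le: "par v \<le> k" for v
    using q(2)[of "v - Suc k"] by (auto simp: par_def spine_parent_def)
  have valid: "valid_network p (G b)" for b
    unfolding G_def using p_bound n par by (intro valid_tree_network) auto
  have c_pos: "1 \<le> c i" if "i \<le> k" for i
    using chain_ge_index[of f, OF f_gt chain that] c0 by simp
  have nb_leaf: "neighbors (G b) v = {par v}" if "k < v" "v < n" for b v
  proof -
    have "par w \<noteq> v" for w using par_le[of w] that(1) by auto
    then show ?thesis using that par[of v] by (auto simp: G_def neighbors_tree_network)
  qed
  let ?L = "\<lambda>i. {v. k < v \<and> v < n \<and> par v = i}"
  have card_L: "card (?L i) = c i" if "i \<le> k" for i
  proof -
    have "?L i = (\<lambda>j. j + Suc k) ` {j. j < (\<Sum>i\<le>k. c i) \<and> q j = i}"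
    proof (intro set_eqI iffI)
      fix v assume "v \<in> ?L i"
      then have "v = (v - Suc k) + Suc k" "v - Suc k \<in> {j. j < (\<Sum>i\<le>k. c i) \<and> q j = i}"
        using n by (auto simp: par_def spine_parent_def)
      then show "v \<in> (\<lambda>j. j + Suc k) ` {j. j < (\<Sum>i\<le>k. c i) \<and> q j = i}" by blast
    qed (use n in \<open>auto simp: par_def spine_parent_def\<close>)
    then show ?thesis using q(1)[OF that] by (simp add: card_image inj_on_def)
  qed
  have nb_spine: "neighbors (G b) v =
      ?L v \<union> (if v < k then {Suc v} else {}) \<union> (if 0 < v then {v - 1} else {})"
    if "v \<le> k" for b v
    using that n by (auto simp: G_def neighbors_tree_network par_def spine_parent_def)
  have deg_leaf: "deg (G b) v = 1" if "k < v" "v < n" for b v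
    using nb_leaf[OF that] by (simp add: deg_def)
  have deg_spine: "deg (G b) v \<noteq> 1" if v: "v \<le> k" for b v
  proof -
    have "?L v \<noteq> {}" using card_L[OF v] c_pos[OF v] by (metis card.empty not_one_le_zero)
    then obtain w where w: "w \<in> ?L v" by blast
    \<comment> \<open>A spine neighbour of \<open>v\<close>; together with the leaf \<open>w\<close>
      it makes the degree at least two.\<close>
    define u where "u = (if v < k then Suc v else v - 1)"
    have "k > 0" using T by simp
    then have "u \<le> k" "u \<in> neighbors (G b) v" "w \<in> neighbors (G b) v"
      using v w unfolding nb_spine[OF v] u_def by auto
    moreover have "u \<noteq> w" using \<open>u \<le> k\<close> w by auto
    moreover have "finite (neighbors (G b) v)" by (simp add: G_def)
    ultimately have "card {u, w} \<le> deg (G b) v"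
      unfolding deg_def by (intro card_mono) auto
    with \<open>u \<noteq> w\<close> show ?thesis by simp
  qed
  have lc_spine: "leaf_count (G b) v = c v" if v: "v \<le> k" for b v
  proof -
    have "{w \<in> neighbors (G b) v. deg (G b) w = 1} = ?L v"
      using v deg_leaf deg_spine by (auto simp: nb_spine[OF v])
    then show ?thesis using card_L[OF v] by (simp add: leaf_count_def)
  qed
  have lc_leaf: "leaf_count (G b) v = 0" if "k < v" "v < n" for b v
  proof -
    have "{w \<in> neighbors (G b) v. deg (G b) w = 1} = {}"
      using deg_spine[OF par_le] by (auto simp: nb_leaf[OF that])
    then show ?thesis by (simp only: leaf_count_def card.empty)
  qed
  \<comment> \<open>Leaves have count 0 and the preceding spine node has a smaller count than
    \<open>v\<close>, so only the next spine node can be heavy.\<close>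
  have heavy: "w = Suc v" if v: "v \<le> k" and w: "w \<in> neighbors (G b) v" "f (c v) \<le> leaf_count (G b) w"
    for b v w
  proof (rule ccontr)
    assume "w \<noteq> Suc v"
    then consider "w \<in> ?L v" | "0 < v" "w = v - 1"
      using w(1) by (auto simp: nb_spine[OF v] split: if_splits)
    then have "leaf_count (G b) w \<le> c v"
    proof cases
      case 2
      then have "c w < c v" using chain_strict[of f, OF f_gt chain, of w] v by simp
      with 2 v show ?thesis by (simp add: lc_spine)
    qed (simp add: lc_leaf)
    with w(2) f_gt[of "c v"] show False by simp
  qed
  \<comment> \<open>Each spine node before \<open>k\<close> has exactly one heavy neighbour and must
    copy its label, so the input of \<open>k\<close> travels back along the spine.\<close>
  have lab: "l i = b k" if l: "increasing_degree f (G b) l" and "i \<le> k" for l b i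
    using \<open>i \<le> k\<close>
  proof (induction rule: inc_induct)
    case base
    \<comment> \<open>The fact \<open>heavy\<close> leaves the number \<open>Suc k\<close> open. It
      is no spine node: if adjacent to \<open>k\<close> at all, it is a leaf with count 0.\<close>
    have "Suc k \<notin> neighbors (G b) k \<or> leaf_count (G b) (Suc k) < f (c k)"
      using nb_spine[of k b] lc_leaf[of "Suc k" b] f_gt[of "c k"] by auto
    then have "leaf_count (G b) w < f (c k)" if "w \<in> neighbors (G b) k" for w
      using heavy[OF order_refl that] that by (cases "f (c k) \<le> leaf_count (G b) w") auto
    then have "balanced f (G b) k"
      unfolding balanced_def lc_spine[OF order_refl] by blast
    with l n show ?case by (auto simp: increasing_degree_def G_def)
  next
    case (step i)
    have i: "i \<le> k" using step by simp
    have "Suc i \<in> neighbors (G b) i" "f (c i) \<le> leaf_count (G b) (Suc i)"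
      using step chain by (auto simp: nb_spine lc_spine chain_def)
    then have "\<not> balanced f (G b) i"
      using deg_spine[OF i] by (auto simp: balanced_def lc_spine[OF i] not_less)
    moreover have "i \<in> nodes (G b)" using i n by (simp add: G_def)
    ultimately obtain w where "w \<in> heavy_neighbors f (G b) i" "l i = l w"
      using l unfolding increasing_degree_def by blast
    with heavy[OF i, of w b] step show ?case by (simp add: heavy_neighbors_def lc_spine[OF i])
  qed
  obtain A where A: "solves p A (increasing_degree f)"
      "\<And>G. valid_network p G \<Longrightarrow> card (nodes G) = n \<Longrightarrow> rounds A G \<le> ?T"
    using round_complexity_attained(2)[of f, OF f_gt] by blast
  have out: "has_output A (G b) ?T 0" "final_output A (G b) 0 = b k" for b
  proof -
    have sol: "\<And>v. v \<in> nodes (G b) \<Longrightarrow> \<exists>t. has_output A (G b) t v"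
        "increasing_degree f (G b) (final_output A (G b))"
      using A(1) valid[of b] by (auto simp: solves_def)
    have "has_output A (G b) (rounds A (G b)) 0"
      by (rule has_output_rounds) (use sol(1) n in \<open>auto simp: G_def\<close>)
    moreover have "rounds A (G b) \<le> ?T"
      by (rule A(2)[OF valid]) (simp add: G_def)
    ultimately show "has_output A (G b) ?T 0" by (rule has_output_mono)
    show "final_output A (G b) 0 = b k" using lab[OF sol(2), of 0] by simp
  qed
  define b where "b = (\<lambda>v. v = k)"
  \<comment> \<open>A leaf gets the position of its spine node, so edges change the position by at
    most one. The two inputs compared differ only at \<open>k\<close>, which has position
    \<open>k\<close>.\<close>
  define pos where "pos v = (if v \<le> k then v else q (v - Suc k))" for v
  have "state A (G b) t 0 = state A (G (\<lambda>_. False)) t 0" if "t \<le> ?T" for t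
    unfolding G_def
  proof (rule state_indistinguishable[where pos = pos and k = k])
    fix u v assume "(v, u) \<in> edges (tree_network n par b)"
    then show "pos u \<le> Suc (pos v)"
      using q(2) by (auto simp: edges_tree_network pos_def par_def spine_parent_def le_SucI
          split: if_splits)
  qed (use that T in \<open>auto simp: pos_def b_def\<close>)
  then have "final_output A (G b) 0 = final_output A (G (\<lambda>_. False)) 0"
    using out(1) by (rule final_output_eqI)
  then show False by (simp add: out(2) b_def)
qed

lemma round_complexity_bounds:
  assumes p_bound: "\<And>n. n \<ge> 1 \<Longrightarrow> n \<le> poly p n"
    and f_gt: "\<And>x. f x > x" and f_double: "\<And>x. f x \<ge> 2 * x"
  shows "round_complexity p (increasing_degree f) n \<le> height f n + 2"
    and "height f n \<le> round_complexity p (increasing_degree f) n + 4"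
proof -
  let ?T = "round_complexity p (increasing_degree f) n"
  show "?T \<le> height f n + 2"
    using round_complexity_attained(1)[of f, OF f_gt] by (simp add: add.commute)
  show "height f n \<le> ?T + 4"
  proof (cases "height f n \<le> 4")
    case False
    then have "height f n = Suc (Suc (Suc (height f n - 3)))" by simp
    then obtain k where k: "height f n = Suc (Suc (Suc k))" by blast
    obtain c0 where c0: "chain f c0 (Suc (Suc (Suc k)))" "c0 (Suc (Suc (Suc k))) \<le> n"
      using height_chain[of f n, OF f_gt] k by metis
    \<comment> \<open>Dropping the first element makes all remaining ones positive; the last two are
      given up below to gain the factor 4.\<close>
    define c where "c = (\<lambda>i. c0 (Suc i))"
    have c: "chain f c (Suc (Suc k))" "c (Suc (Suc k)) \<le> n" "1 \<le> c 0"
      using chain_tail[OF c0(1)] c0(2) chain_strict[of f, OF f_gt c0(1), of 0] by (auto simp: c_def)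
    have "2 * c k \<le> c (Suc k)" "2 * c (Suc k) \<le> c (Suc (Suc k))"
      using c(1) f_double unfolding chain_def by (meson le_trans lessI less_SucI)+
    then have quarter: "4 * c k \<le> n" using c(2) by simp
    have ck: "chain f c k" using c(1) by (simp add: chain_def)
    have "Suc k \<le> c k" using chain_ge_index[of f, OF f_gt ck, of k] c(3) by simp
    moreover have "(\<Sum>i\<le>k. c i) \<le> 2 * c k" using chain_sum_le[of f, OF f_double ck] .
    \<comment> \<open>The leaves number at most \<open>2 * c k\<close> and the spine has at most
      \<open>c k\<close> nodes, which leaves room within \<open>4 * c k \<le> n\<close>.\<close>
    ultimately have small: "(\<Sum>i\<le>k. c i) + Suc k \<le> n" using quarter by simp
    \<comment> \<open>The last spine node takes all surplus leaves, making the size exactly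
      \<open>n\<close>. Enlarging the last element preserves the chain.\<close>
    define d where "d = c(k := n - (\<Sum>i<k. c i) - Suc k)"
    have split: "(\<Sum>i\<le>k. c i) = (\<Sum>i<k. c i) + c k"
      by (simp add: lessThan_Suc_atMost[symmetric])
    have "(\<Sum>i\<le>k. d i) = (\<Sum>i<k. c i) + (n - (\<Sum>i<k. c i) - Suc k)"
      by (simp add: lessThan_Suc_atMost[symmetric] d_def)
    then have "(\<Sum>i\<le>k. d i) + Suc k = n" using small split by simp
    moreover have dk: "c i \<le> d i" for i using small split by (auto simp: d_def)
    then have "1 \<le> d 0" using c(3) by (meson le_trans)
    moreover have "f (d i) \<le> d (Suc i)" if "i < k" for i
      using that ck dk[of "Suc i"] by (auto simp: chain_def d_def intro: le_trans)
    then have "chain f d k" by (simp add: chain_def)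
    ultimately have "k \<le> ?T"
      using round_complexity_ge[of p f, OF p_bound f_gt] by blast
    then show ?thesis using k by simp
  qed simp
qed


section \<open>Towers and the iterated logarithm\<close>

primrec tower :: "nat \<Rightarrow> nat" where
  "tower 0 = 1"
| "tower (Suc k) = 2 ^ tower k"

lemma tower_gt: "k < tower k"
proof (induction k)
  case (Suc k)
  then have "Suc k \<le> tower k" by simp
  also have "tower k < tower (Suc k)" using less_exp[of "tower k"] by simp
  finally show ?case .
qed simp

lemma strict_mono_tower: "strict_mono tower"
  by (simp add: strict_mono_Suc_iff)

text \<open>Once an iterate is at most 1, later ones may be logarithms of nonpositive numbers, hence
  "some \<open>j \<le> k\<close>" instead of the \<open>k\<close>-th iterate. In the step
  \<open>y > 1\<close> rules out \<open>j = 0\<close> and makes \<open>log\<close>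
  invertible.\<close>

lemma log_iterates_le_tower: "(\<exists>j\<le>k. (log 2 ^^ j) y \<le> 1) \<longleftrightarrow> y \<le> real (tower k)"
proof (induction k arbitrary: y)
  case (Suc k)
  show ?case
  proof (cases "y \<le> 1")
    case True
    moreover have "1 \<le> real (tower (Suc k))" by simp
    ultimately have "y \<le> real (tower (Suc k))" by linarith
    moreover have "(log 2 ^^ 0) y \<le> 1" using True by simp
    ultimately show ?thesis by blast
  next
    case False
    then have "(\<exists>j\<le>Suc k. (log 2 ^^ j) y \<le> 1) \<longleftrightarrow> (\<exists>j\<le>k. (log 2 ^^ Suc j) y \<le> 1)"
      by (metis Suc_le_mono funpow_0 not0_implies_Suc)
    also have "\<dots> \<longleftrightarrow> log 2 y \<le> real (tower k)"
      unfolding funpow_Suc_right o_def by (rule Suc)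
    also have "\<dots> \<longleftrightarrow> y \<le> real (tower (Suc k))"
      using False by (simp add: log_le_iff powr_realpow)
    finally show ?thesis .
  qed
qed simp

text \<open>A Galois connection between \<open>log_star\<close> and \<open>tower\<close>, from which
  the remaining properties of \<open>log_star\<close> follow.\<close>

lemma log_star_le_iff: "log_star n \<le> k \<longleftrightarrow> n \<le> tower k"
proof
  assume "log_star n \<le> k"
  have "\<exists>j. (log 2 ^^ j) (real n) \<le> 1"
    using log_iterates_le_tower[of n "real n"] tower_gt[of n] by auto
  then have "(log 2 ^^ log_star n) (real n) \<le> 1"
    unfolding log_star_def by (rule LeastI_ex)
  then show "n \<le> tower k"
    using log_iterates_le_tower[of k "real n"] \<open>log_star n \<le> k\<close> by auto
next
  assume "n \<le> tower k"
  then obtain j where "j \<le> k" "(log 2 ^^ j) (real n) \<le> 1"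
    using log_iterates_le_tower[of k "real n"] by auto
  then show "log_star n \<le> k"
    unfolding log_star_def by (meson Least_le le_trans)
qed

lemma le_tower_log_star: "n \<le> tower (log_star n)"
  by (simp add: log_star_le_iff[symmetric])

lemma log_star_tower [simp]: "log_star (tower k) = k"
proof (rule antisym)
  show "k \<le> log_star (tower k)"
    using le_tower_log_star[of "tower k"] by (simp only: strict_mono_less_eq[OF strict_mono_tower])
qed (simp add: log_star_le_iff)

lemma mono_log_star: "m \<le> n \<Longrightarrow> log_star m \<le> log_star n"
  unfolding log_star_le_iff[of m] by (rule order_trans[OF _ le_tower_log_star])

lemma filterlim_log_star: "filterlim log_star at_top sequentially"
  unfolding filterlim_at_top_ge[where c = 0]
proof (intro allI impI)
  fix k
  show "\<forall>\<^sub>F n in sequentially. k \<le> log_star n"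
    using eventually_ge_at_top[of "tower k"]
    by eventually_elim (metis log_star_tower mono_log_star)
qed


section \<open>Slowing down a problem\<close>

text \<open>As \<open>log_star 0\<close> and \<open>log_star 1\<close> are both 0, the general
  formula would give 0 and 1 the same value; the exception at 0 secures the required value
  1.\<close>

definition lift :: "(nat \<Rightarrow> nat) \<Rightarrow> nat \<Rightarrow> nat" where
  "lift f x = (if x = 0 then 1 else tower (f (log_star x)))"

text \<open>\<open>f\<close> raises \<open>log_star x\<close> by at least one, which adds an
  exponential on top of a tower that already reaches \<open>x\<close>. Both growth conditions for
  \<open>lift f\<close> follow.\<close>

lemma lift_ge_power:
  assumes f_gt: "\<And>x. f x > x"
  shows "2 ^ x \<le> lift f x"
proof (cases "x = 0")
  case False
  have "2 ^ x \<le> (2 :: nat) ^ tower (log_star x)"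
    by (rule power_increasing[OF le_tower_log_star]) simp
  also have "\<dots> = tower (Suc (log_star x))" by simp
  also have "\<dots> \<le> tower (f (log_star x))"
    unfolding strict_mono_less_eq[OF strict_mono_tower] using f_gt by (simp add: Suc_le_eq)
  finally show ?thesis using False by (simp add: lift_def)
qed (simp add: lift_def)

lemma lift_gt: "(\<And>x. f x > x) \<Longrightarrow> lift f x > x"
  by (rule less_le_trans[OF less_exp lift_ge_power])

lemma lift_double:
  assumes f_gt: "\<And>x. f x > x"
  shows "2 * x \<le> lift f x"
proof (cases x)
  case (Suc y)
  have "Suc y \<le> 2 ^ y" using less_exp[of y] by (rule Suc_leI)
  then have "2 * x \<le> 2 ^ x" using Suc by simp
  also have "\<dots> \<le> lift f x" using lift_ge_power[of f, OF f_gt] .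
  finally show ?thesis .
qed simp

text \<open>\<open>log_star\<close> is monotone and undoes \<open>tower\<close>, so it maps chains
  for \<open>lift f\<close> to chains for \<open>f\<close>. The first element is dropped because it
  may be 0, where \<open>lift\<close> is exceptional.\<close>

lemma height_lift_le:
  assumes f_gt: "\<And>x. f x > x"
  shows "height (lift f) n \<le> height f (log_star n) + 1"
proof (cases "height (lift f) n")
  case (Suc k)
  obtain c where c: "chain (lift f) c (Suc k)" "c (Suc k) \<le> n"
    using height_chain[of "lift f" n] lift_gt[of f, OF f_gt] Suc by metis
  have gt: "\<And>x. lift f x > x" using lift_gt[of f, OF f_gt] .
  have "f (log_star (c (Suc i))) \<le> log_star (c (Suc (Suc i)))" if "i < k" for i
  proof -
    have "c (Suc i) \<noteq> 0" using chain_strict[of "lift f", OF gt c(1), of i] that by simp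
    then have "tower (f (log_star (c (Suc i)))) \<le> c (Suc (Suc i))"
      using c(1) that by (auto simp: chain_def lift_def dest!: spec[of _ "Suc i"])
    then show ?thesis by (metis log_star_tower mono_log_star)
  qed
  then have "chain f (\<lambda>i. log_star (c (Suc i))) k" by (simp add: chain_def)
  from height_ge[of f, OF f_gt this mono_log_star[OF c(2)]] Suc show ?thesis by simp
qed simp

text \<open>Conversely \<open>tower\<close> maps chains for \<open>f\<close> to chains for
  \<open>lift f\<close>. The last element is dropped because the tower over
  \<open>log_star n\<close> may exceed \<open>n\<close>, whereas any smaller height stays
  below.\<close>

lemma height_le_lift:
  assumes f_gt: "\<And>x. f x > x"
  shows "height f (log_star n) \<le> height (lift f) n + 1"
proof (cases "height f (log_star n)")
  case (Suc k)
  obtain c where c: "chain f c (Suc k)" "c (Suc k) \<le> log_star n"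
    using height_chain[of f "log_star n", OF f_gt] Suc by metis
  have "c k < log_star n" using chain_strict[of f, OF f_gt c(1), of k] c(2) by simp
  then have "tower (c k) \<le> n" using log_star_le_iff[of n "c k"] by simp
  moreover have "chain (lift f) (\<lambda>i. tower (c i)) k"
    using c(1) tower_gt
    by (auto simp: chain_def lift_def strict_mono_less_eq[OF strict_mono_tower] Suc_le_eq
        intro: le_less_trans[OF le0])
  moreover have "\<And>x. lift f x > x" using lift_gt[of f, OF f_gt] .
  ultimately have "k \<le> height (lift f) n" using height_ge[of "lift f"] by blast
  with Suc show ?thesis by simp
qed simp

theorem theorem13:
  fixes f :: "nat \<Rightarrow> nat" and p :: "nat poly"
  assumes p_bound: "\<And>n. n \<ge> 1 \<Longrightarrow> n \<le> poly p n"
    and f0: "f 0 = 1" and f1: "f 1 = 2"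
    and f_gt: "\<And>x. f x > x" and f_double: "\<And>x. f x \<ge> 2 * x"
  shows "\<exists>g :: nat \<Rightarrow> nat. g 0 = 1 \<and> g 1 = 2 \<and> (\<forall>x. g x > x) \<and>
    (\<lambda>n. real (round_complexity p (increasing_degree g) n))
      \<in> \<Theta>(\<lambda>n. real (round_complexity p (increasing_degree f) (log_star n)))"
proof (intro exI conjI)
  have g_gt: "\<And>x. lift f x > x" using lift_gt[of f, OF f_gt] .
  have g_double: "\<And>x. 2 * x \<le> lift f x" using lift_double[of f, OF f_gt] .
  show "lift f 0 = 1" by (simp add: lift_def)
  have "log_star 1 = 0" using log_star_tower[of 0] by simp
  then show "lift f 1 = 2" by (simp add: lift_def f0)
  show "\<forall>x. lift f x > x" using g_gt by blast
  define Tf where "Tf = (\<lambda>n. round_complexity p (increasing_degree f) (log_star n))"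
  define Tg where "Tg = round_complexity p (increasing_degree (lift f))"
  \<comment> \<open>The 7 is 2 + 1 + 4: the upper bound of one problem, the comparison of heights,
    and the lower bound of the other.\<close>
  have upper: "Tg n \<le> Tf n + 7" and lower: "Tf n \<le> Tg n + 7" for n
    using round_complexity_bounds[of p f "log_star n", OF p_bound f_gt f_double]
      round_complexity_bounds[of p "lift f" n, OF p_bound g_gt g_double]
      height_lift_le[of f n, OF f_gt] height_le_lift[of f n, OF f_gt]
    unfolding Tf_def Tg_def by linarith+
  \<comment> \<open>18 = 14 + 4 ensures \<open>14 \<le> Tf n\<close>; as 14 is twice 7, both
    additive errors are then absorbed by a factor of 2.\<close>
  have "\<forall>\<^sub>F n in sequentially. 18 \<le> height f (log_star n)"
    by (rule eventually_compose_filterlim[OF height_unbounded[of f, OF f_gt] filterlim_log_star])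
  then have large: "\<forall>\<^sub>F n in sequentially. 14 \<le> Tf n"
  proof eventually_elim
    case (elim n)
    with round_complexity_bounds(2)[of p f "log_star n", OF p_bound f_gt f_double]
    show ?case by (simp add: Tf_def)
  qed
  have "(\<lambda>n. real (Tg n)) \<in> \<Theta>(\<lambda>n. real (Tf n))"
  proof (rule bigthetaI)
    show "(\<lambda>n. real (Tg n)) \<in> O(\<lambda>n. real (Tf n))"
    proof (rule bigoI)
      show "\<forall>\<^sub>F n in sequentially. norm (real (Tg n)) \<le> 2 * norm (real (Tf n))"
        using large
      proof eventually_elim
        case (elim n)
        with upper[of n] have "Tg n \<le> 2 * Tf n" by simp
        then show ?case by simp
      qed
    qed
    show "(\<lambda>n. real (Tg n)) \<in> \<Omega>(\<lambda>n. real (Tf n))"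
    proof (rule landau_omega.bigI)
      show "(1 / 2 :: real) > 0" by simp
      show "\<forall>\<^sub>F n in sequentially. norm (real (Tg n)) \<ge> 1 / 2 * norm (real (Tf n))"
        using large
      proof eventually_elim
        case (elim n)
        with lower[of n] have "Tf n \<le> 2 * Tg n" by simp
        then show ?case by simp
      qed
    qed
  qed
  then show "(\<lambda>n. real (round_complexity p (increasing_degree (lift f)) n))
      \<in> \<Theta>(\<lambda>n. real (round_complexity p (increasing_degree f) (log_star n)))"
    by (simp add: Tf_def Tg_def)
qed

end
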